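(* Let $\Omega=\mathbb{R}^3$ or $\mathbb{T}^3=\mathbb{R}^3/(L\mathbb{Z})^3$, and let $u$ be a Leray solution of the Navier-Stokes system (NS) with $u_0\in L^2\cap L^1(\Omega)$. Then for any $T_0<T_1$ the averaged energy spectrum on $[T_0,T_1]$ satisfies, on $\mathbb{R}^3$, for all $K>0$, $$\bar E^\ast(K)\le\frac{4}{\pi^2}\,\operatorname{Vol}(u;[T_0,T_1])\,K^2\,\bar E,$$ and, on $\mathbb{T}^3$, for all $K=2\pi L^{-1}\sqrt n$ with $n\ge1$ an integer that is a sum of three squares, $$\bar E^\dagger(K)\le\operatorname{Vol}(u;[T_0,T_1])\,K^2\,\bar E\times\frac{1}{8\pi^3\sqrt n}\operatorname{Card}\{z\in\mathbb{Z}^3:|z|^2=n\}.$$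
   Context: (NS) is $\partial_tu-\nu\Delta u+(u\cdot\nabla)u=-\nabla\Pi$, $\operatorname{div}u=0$, $u|_{t=0}=u_0$ on $\mathbb{R}_+\times\Omega$, with $\nu>0$. A Leray solution is a weak solution in $L^\infty(\mathbb{R}_+;L^2(\Omega))\cap L^2(\mathbb{R}_+;\dot H^1(\Omega))$ satisfying the energy inequality $\|u(t)\|_{L^2}^2+2\nu\int_{t'}^t\|\nabla u\|_{L^2}^2\le\|u(t')\|_{L^2}^2$ for a.e. $t>t'$. $\rho=1$ on $\mathbb{R}^3$, $\rho=L^{-3}$ on $\mathbb{T}^3$; $E(t)=\rho\|u(t)\|_{L^2}^2$. Time averages: $\bar f=\langle f\rangle=\frac1{T_1-T_0}\int_{T_0}^{T_1}f\,dt$. $\operatorname{Vol}(u;[T_0,T_1])=\langle\|u\|_{L^1(\Omega)}^2\rangle/\langle\|u\|_{L^2(\Omega)}^2\rangle$. $\hat u(t,\xi)=\int_\Omega e^{-ix\cdot\xi}u(t,x)dx$. On $\mathbb{R}^3$, $E^\ast(K,t)=\frac{\rho}{K}\int_{\mathbb{R}^3}\psi(|\xi|/K)|\hat u(t,\xi)|^2\frac{d\xi}{(2\pi)^3}$ where $\psi\ge0$ is a smooth bump function supported in $[2^{-1},2]$ with $\int_0^\infty\psi(r)\frac{dr}r=1$. On $\mathbb{T}^3$, for $K=|\mathbf{k}|\neq0$ with $\mathbf{k}\in(2\pi L^{-1}\mathbb{Z})^3$, $E^\dagger(K,t)=(2\pi)^{-2}\rho\frac KL\sum_{\mathbf{k}\in(2\pi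 L^{-1}\mathbb{Z})^3,|\mathbf{k}|=K}|\hat u(t,\mathbf{k})|^2$. *)

theory Defs
  imports "HOL-Analysis.Analysis"
begin

section \<open>The domain\<close>

text \<open>Functions on the torus of side length \<open>L\<close> are represented by \<open>L\<close>-periodic functions on
  the whole space, integrated over the fundamental cell.\<close>

datatype domain = Whole | Torus real

definition periodic :: "real \<Rightarrow> (real^3 \<Rightarrow> 'b) \<Rightarrow> bool" where
  "periodic L f \<longleftrightarrow> (\<forall>x i. f (x + L *\<^sub>R axis i 1) = f x)"

fun lives_on :: "domain \<Rightarrow> (real^3 \<Rightarrow> 'b) \<Rightarrow> bool" where
  "lives_on Whole f = True"
| "lives_on (Torus L) f = periodic L f"

fun cell :: "domain \<Rightarrow> (real^3) set" where
  "cell Whole = UNIV"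
| "cell (Torus L) = {x. \<forall>i. 0 \<le> x $ i \<and> x $ i < L}"

fun rho :: "domain \<Rightarrow> real" where
  "rho Whole = 1"
| "rho (Torus L) = 1 / L ^ 3"

section \<open>Norms\<close>

text \<open>Norms and time averages take values in \<open>[0, \<infinity>]\<close>. On \<open>real^3^3\<close> the library norm is the
  Frobenius norm.\<close>

definition L1_norm :: "domain \<Rightarrow> (real^3 \<Rightarrow> 'b::real_normed_vector) \<Rightarrow> ennreal" where
  "L1_norm \<Omega> f = (\<integral>\<^sup>+x\<in>cell \<Omega>. ennreal (norm (f x)) \<partial>lborel)"

definition L2_norm_sq :: "domain \<Rightarrow> (real^3 \<Rightarrow> 'b::real_normed_vector) \<Rightarrow> ennreal" where
  "L2_norm_sq \<Omega> f = (\<integral>\<^sup>+x\<in>cell \<Omega>. ennreal ((norm (f x))\<^sup>2) \<partial>lborel)"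

definition in_L1 :: "domain \<Rightarrow> (real^3 \<Rightarrow> real^3) \<Rightarrow> bool" where
  "in_L1 \<Omega> f \<longleftrightarrow> f \<in> borel_measurable borel \<and> lives_on \<Omega> f \<and> L1_norm \<Omega> f < \<infinity>"

definition in_L2 :: "domain \<Rightarrow> (real^3 \<Rightarrow> real^3) \<Rightarrow> bool" where
  "in_L2 \<Omega> f \<longleftrightarrow> f \<in> borel_measurable borel \<and> lives_on \<Omega> f \<and> L2_norm_sq \<Omega> f < \<infinity>"

section \<open>Test functions\<close>

primrec Ck :: "nat \<Rightarrow> ('a::real_normed_vector \<Rightarrow> 'b::real_normed_vector) \<Rightarrow> bool" where
  "Ck 0 f = continuous_on UNIV f"
| "Ck (Suc k) f = ((\<forall>x. f differentiable (at x)) \<and> (\<forall>v. Ck k (\<lambda>x. frechet_derivative f (at x) v)))"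

definition smooth :: "('a::real_normed_vector \<Rightarrow> 'b::real_normed_vector) \<Rightarrow> bool" where
  "smooth f \<longleftrightarrow> (\<forall>k. Ck k f)"

fun test_function :: "domain \<Rightarrow> (real^3 \<Rightarrow> real) \<Rightarrow> bool" where
  "test_function Whole \<eta> = (smooth \<eta> \<and> bounded {x. \<eta> x \<noteq> 0})"
| "test_function (Torus L) \<eta> = (smooth \<eta> \<and> periodic L \<eta>)"

text \<open>Space-time test fields are restrictions to \<open>t \<ge> 0\<close> of compactly supported smooth fields;
  they need not vanish at \<open>t = 0\<close>.\<close>

fun test_field :: "domain \<Rightarrow> (real \<Rightarrow> real^3 \<Rightarrow> real^3) \<Rightarrow> bool" where
  "test_field Whole \<phi> = (smooth (\<lambda>(t, x). \<phi> t x) \<and> bounded {(t, x). \<phi> t x \<noteq> 0})"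
| "test_field (Torus L) \<phi> =
     (smooth (\<lambda>(t, x). \<phi> t x) \<and> bounded {t. \<exists>x. \<phi> t x \<noteq> 0} \<and> (\<forall>t. periodic L (\<phi> t)))"

section \<open>Differential operators\<close>

definition pd :: "3 \<Rightarrow> (real^3 \<Rightarrow> 'b::real_normed_vector) \<Rightarrow> real^3 \<Rightarrow> 'b" where
  "pd i f x = frechet_derivative f (at x) (axis i 1)"

definition grad :: "(real^3 \<Rightarrow> real) \<Rightarrow> real^3 \<Rightarrow> real^3" where
  "grad \<eta> x = (\<chi> i. pd i \<eta> x)"

definition divergence :: "(real^3 \<Rightarrow> real^3) \<Rightarrow> real^3 \<Rightarrow> real" where
  "divergence f x = (\<Sum>i\<in>UNIV. pd i f x $ i)"

definition laplacian :: "(real^3 \<Rightarrow> real^3) \<Rightarrow> real^3 \<Rightarrow> real^3" where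
  "laplacian f x = (\<Sum>i\<in>UNIV. pd i (pd i f) x)"

definition weakly_div_free :: "domain \<Rightarrow> (real^3 \<Rightarrow> real^3) \<Rightarrow> bool" where
  "weakly_div_free \<Omega> f \<longleftrightarrow>
     (\<forall>\<eta>. test_function \<Omega> \<eta> \<longrightarrow> (LINT x:cell \<Omega>|lborel. f x \<bullet> grad \<eta> x) = 0)"

definition weak_gradient :: "domain \<Rightarrow> (real^3 \<Rightarrow> real^3) \<Rightarrow> (real^3 \<Rightarrow> real^3^3) \<Rightarrow> bool" where
  "weak_gradient \<Omega> f G \<longleftrightarrow>
     (\<forall>\<eta>. test_function \<Omega> \<eta> \<longrightarrow> (\<forall>i j.
        (LINT x:cell \<Omega>|lborel. f x $ j * pd i \<eta> x) = - (LINT x:cell \<Omega>|lborel. G x $ i $ j * \<eta> x)))"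

section \<open>Leray solutions\<close>

text \<open>The momentum equation is tested against divergence-free fields, which eliminates the pressure;
  \<open>(u \<cdot> \<nabla>) u = div (u \<otimes> u)\<close> is integrated by parts.\<close>

definition weak_momentum ::
  "domain \<Rightarrow> real \<Rightarrow> (real^3 \<Rightarrow> real^3) \<Rightarrow> (real \<Rightarrow> real^3 \<Rightarrow> real^3) \<Rightarrow> bool" where
  "weak_momentum \<Omega> \<nu> u0 u \<longleftrightarrow>
     (\<forall>\<phi>. test_field \<Omega> \<phi> \<and> (\<forall>t x. divergence (\<phi> t) x = 0) \<longrightarrow>
        (LINT (t, x):{0..} \<times> cell \<Omega>|lborel.
            u t x \<bullet> vector_derivative (\<lambda>s. \<phi> s x) (at t)
          + \<nu> * (u t x \<bullet> laplacian (\<phi> t) x)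
          + (\<Sum>i\<in>UNIV. u t x $ i * (u t x \<bullet> pd i (\<phi> t) x)))
        + (LINT x:cell \<Omega>|lborel. u0 x \<bullet> \<phi> 0 x) = 0)"

text \<open>In the energy inequality both \<open>t'\<close> and \<open>t > t'\<close> range over almost all times.\<close>

definition leray_solution ::
  "domain \<Rightarrow> real \<Rightarrow> (real^3 \<Rightarrow> real^3) \<Rightarrow> (real \<Rightarrow> real^3 \<Rightarrow> real^3) \<Rightarrow> bool" where
  "leray_solution \<Omega> \<nu> u0 u \<longleftrightarrow>
     in_L2 \<Omega> u0 \<and> weakly_div_free \<Omega> u0 \<and>
     (\<lambda>(t, x). u t x) \<in> borel_measurable (restrict_space borel ({0..} \<times> UNIV)) \<and>
     (\<forall>t\<ge>0. lives_on \<Omega> (u t)) \<and>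
     (\<exists>C::real. AE t in lborel. 0 \<le> t \<longrightarrow> L2_norm_sq \<Omega> (u t) \<le> ennreal C) \<and>
     (AE t in lborel. 0 \<le> t \<longrightarrow> weakly_div_free \<Omega> (u t)) \<and>
     weak_momentum \<Omega> \<nu> u0 u \<and>
     (\<exists>G :: real \<Rightarrow> real^3 \<Rightarrow> real^3^3.
        (\<lambda>(t, x). G t x) \<in> borel_measurable (restrict_space borel ({0..} \<times> UNIV)) \<and>
        (\<forall>t\<ge>0. lives_on \<Omega> (G t)) \<and>
        (AE t in lborel. 0 \<le> t \<longrightarrow> weak_gradient \<Omega> (u t) (G t)) \<and>
        (\<integral>\<^sup>+t\<in>{0..}. L2_norm_sq \<Omega> (G t) \<partial>lborel) < \<infinity> \<and>
        (AE t' in lborel. 0 \<le> t' \<longrightarrow> (AE t in lborel. t' < t \<longrightarrow>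
           L2_norm_sq \<Omega> (u t) + ennreal (2 * \<nu>) * (\<integral>\<^sup>+s\<in>{t'..t}. L2_norm_sq \<Omega> (G s) \<partial>lborel)
             \<le> L2_norm_sq \<Omega> (u t'))))"

section \<open>Energy, volume and energy spectra\<close>

definition time_average :: "real \<Rightarrow> real \<Rightarrow> (real \<Rightarrow> ennreal) \<Rightarrow> ennreal" where
  "time_average T0 T1 f = (\<integral>\<^sup>+t\<in>{T0..T1}. f t \<partial>lborel) / ennreal (T1 - T0)"

definition energy :: "domain \<Rightarrow> (real^3 \<Rightarrow> real^3) \<Rightarrow> ennreal" where
  "energy \<Omega> f = ennreal (rho \<Omega>) * L2_norm_sq \<Omega> f"

text \<open>With the conventions of \<open>ennreal\<close>, \<open>Vol = 0\<close> if \<open>u\<close> vanishes almost everywhere on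
  the time interval.\<close>

definition Vol :: "domain \<Rightarrow> (real \<Rightarrow> real^3 \<Rightarrow> real^3) \<Rightarrow> real \<Rightarrow> real \<Rightarrow> ennreal" where
  "Vol \<Omega> u T0 T1 =
     time_average T0 T1 (\<lambda>t. (L1_norm \<Omega> (u t))\<^sup>2) / time_average T0 T1 (\<lambda>t. L2_norm_sq \<Omega> (u t))"

definition fourier :: "domain \<Rightarrow> (real^3 \<Rightarrow> real^3) \<Rightarrow> real^3 \<Rightarrow> complex^3" where
  "fourier \<Omega> f \<xi> =
     (LINT x:cell \<Omega>|lborel. (\<chi> j. exp (- \<i> * complex_of_real (x \<bullet> \<xi>)) * complex_of_real (f x $ j)))"

definition spectral_bump :: "(real \<Rightarrow> real) \<Rightarrow> bool" where
  "spectral_bump \<psi> \<longleftrightarrow>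
     smooth \<psi> \<and> (\<forall>r. 0 \<le> \<psi> r) \<and> closure {r. \<psi> r \<noteq> 0} \<subseteq> {1/2..2} \<and>
     (LINT r:{0<..}|lborel. \<psi> r / r) = 1"

definition E_star :: "(real \<Rightarrow> real) \<Rightarrow> real \<Rightarrow> (real^3 \<Rightarrow> real^3) \<Rightarrow> ennreal" where
  "E_star \<psi> K f = ennreal (rho Whole / K) *
     (\<integral>\<^sup>+\<xi>. ennreal (\<psi> (norm \<xi> / K) * (norm (fourier Whole f \<xi>))\<^sup>2 / (2 * pi) ^ 3) \<partial>lborel)"

definition dual_lattice :: "real \<Rightarrow> (real^3) set" where
  "dual_lattice L = {k. \<forall>i. \<exists>m::int. k $ i = 2 * pi / L * of_int m}"

definition E_dagger :: "real \<Rightarrow> real \<Rightarrow> (real^3 \<Rightarrow> real^3) \<Rightarrow> ennreal" where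
  "E_dagger L K f = ennreal (1 / (2 * pi)\<^sup>2 * rho (Torus L) * (K / L) *
     (\<Sum>k\<in>{k \<in> dual_lattice L. norm k = K}. (norm (fourier (Torus L) f k))\<^sup>2))"

end

theory Submission
  imports Defs
begin

text \<open>The bound \<open>|\<F> u(\<xi>)| \<le> \<parallel>u\<parallel>\<^sub>1\<close> holds at every time, so the spectrum at \<open>K\<close> is at most \<open>\<parallel>u\<parallel>\<^sub>1\<^sup>2\<close>
  times the mass of the frequency shell. On the whole space that mass is
  \<open>4 \<pi> K\<^sup>2 / (2 \<pi>)\<^sup>3 \<cdot> \<integral> \<psi>(r) r\<^sup>2 dr\<close>, and \<open>r\<^sup>3 \<le> 8\<close> on the support of \<open>\<psi>\<close> yields the factor \<open>4 / \<pi>\<^sup>2\<close>;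
  on the torus it is a count of lattice points. Averaging in time turns \<open>\<parallel>u\<parallel>\<^sub>1\<^sup>2\<close> into the volume
  times the mean of \<open>\<parallel>u\<parallel>\<^sub>2\<^sup>2\<close>.\<close>

section \<open>The radial part of Lebesgue measure on three-space\<close>

text \<open>Polar coordinates obtained from ball volumes alone: both measures give
  \<open>{..a}\<close> the mass \<open>4/3 * pi * a^3\<close> for \<open>a \<ge> 0\<close> and
  \<open>0\<close> otherwise, and these half-lines form an intersection-stable generator of the
  Borel sets.\<close>

lemma distr_norm_lborel_3:
  "distr (lborel :: (real^3) measure) borel norm
     = density lborel (\<lambda>r::real. ennreal (4 * pi * r\<^sup>2) * indicator {0..} r)"
    (is "?M = ?N")
proof -
  have on_atMost: "emeasure ?M {..a} = emeasure ?N {..a}"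
    and finite_atMost: "emeasure ?M {..a} \<noteq> \<infinity>" for a :: real
  proof -
    have vimage: "norm -` {..a} = (cball 0 a :: (real^3) set)"
      by (auto simp: cball_def dist_norm)
    have M: "emeasure ?M {..a} = emeasure lborel (cball 0 a :: (real^3) set)"
      by (subst emeasure_distr) (auto simp: vimage)
    have N: "emeasure ?N {..a} = (\<integral>\<^sup>+r. ennreal (4 * pi * r\<^sup>2) * indicator {0..a} r \<partial>lborel)"
      by (subst emeasure_density) (auto intro!: nn_integral_cong split: split_indicator)
    show "emeasure ?M {..a} = emeasure ?N {..a}"
    proof (cases "a \<ge> 0")
      case True
      have "(\<integral>\<^sup>+r. ennreal (4 * pi * r\<^sup>2) * indicator {0..a} r \<partial>lborel)
          = ennreal (4 / 3 * pi * a ^ 3 - 4 / 3 * pi * 0 ^ 3)"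
        by (rule nn_integral_FTC_Icc[where F = "\<lambda>r. 4 / 3 * pi * r ^ 3"])
           (use True in \<open>auto intro!: derivative_eq_intros simp: power2_eq_square\<close>)
      then show ?thesis
        using True by (simp add: M N emeasure_cball unit_ball_vol_3)
    qed (simp add: M N not_le)
    \<comment> \<open>Finite mass on the exhausting sets \<open>{..real n}\<close> lets equality on
      the generator extend to all Borel sets.\<close>
    show "emeasure ?M {..a} \<noteq> \<infinity>"
      unfolding M using emeasure_lborel_cball_finite[of "0 :: real^3" a] by simp
  qed
  show ?thesis
  proof (rule measure_eqI_generator_eq[where E = "range atMost" and \<Omega> = UNIV
          and A = "\<lambda>n. {..real n}"])
    show "Int_stable (range (atMost :: real \<Rightarrow> real set))"
      by (auto simp: Int_stable_def)
    show "(\<Union>n. {..real n}) = UNIV"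
      using real_arch_simple by auto
    show "sets ?M = sigma_sets UNIV (range atMost)"
      by (simp add: borel_eq_atMost full_SetCompr_eq)
    then show "sets ?N = sigma_sets UNIV (range atMost)"
      by simp
  qed (use on_atMost finite_atMost in auto)
qed

lemma nn_integral_radial_3:
  fixes g :: "real \<Rightarrow> ennreal"
  assumes [measurable]: "g \<in> borel_measurable borel"
  shows "(\<integral>\<^sup>+\<xi>. g (norm (\<xi> :: real^3)) \<partial>lborel)
    = (\<integral>\<^sup>+r\<in>{0..}. ennreal (4 * pi * r\<^sup>2) * g r \<partial>lborel)"
proof -
  have "(\<integral>\<^sup>+\<xi>. g (norm (\<xi> :: real^3)) \<partial>lborel) = (\<integral>\<^sup>+r. g r \<partial>distr (lborel :: (real^3) measure) borel norm)"
    by (simp add: nn_integral_distr)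
  also have "\<dots> = (\<integral>\<^sup>+r\<in>{0..}. ennreal (4 * pi * r\<^sup>2) * g r \<partial>lborel)"
    unfolding distr_norm_lborel_3
    by (subst nn_integral_density) (auto simp: mult_ac)
  finally show ?thesis .
qed

section \<open>Mass of the spectral bump\<close>

lemma spectral_bump_measurable:
  assumes "spectral_bump \<psi>"
  shows "\<psi> \<in> borel_measurable borel"
proof -
  have "Ck 0 \<psi>"
    using assms unfolding spectral_bump_def smooth_def by blast
  then show ?thesis
    by (simp add: borel_measurable_continuous_onI)
qed

lemma spectral_bump_nonneg: "spectral_bump \<psi> \<Longrightarrow> 0 \<le> \<psi> r"
  by (simp add: spectral_bump_def)

lemma spectral_bump_eq_0:
  assumes "spectral_bump \<psi>" and "2 < r"
  shows "\<psi> r = 0"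
  using assms closure_subset[of "{r. \<psi> r \<noteq> 0}"] unfolding spectral_bump_def by fastforce

lemma nn_integral_spectral_bump:
  assumes "spectral_bump \<psi>"
  shows "(\<integral>\<^sup>+r. ennreal (\<psi> r / r) * indicator {0<..} r \<partial>lborel) = 1"
proof -
  have eq1: "(LINT r|lborel. indicator {0<..} r *\<^sub>R (\<psi> r / r)) = 1"
    using assms by (simp add: spectral_bump_def set_lebesgue_integral_def)
  \<comment> \<open>A non-integrable function has Bochner integral \<open>0\<close> by default, so
    the value \<open>1\<close> forces integrability.\<close>
  then have int: "integrable lborel (\<lambda>r. indicator {0<..} r *\<^sub>R (\<psi> r / r))"
    using not_integrable_integral_eq by fastforce
  have "(\<integral>\<^sup>+r. ennreal (\<psi> r / r) * indicator {0<..} r \<partial>lborel)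
      = (\<integral>\<^sup>+r. ennreal (indicator {0<..} r *\<^sub>R (\<psi> r / r)) \<partial>lborel)"
    by (intro nn_integral_cong) (auto split: split_indicator)
  also have "\<dots> = ennreal 1"
    by (subst nn_integral_eq_integral[OF int])
       (auto simp: eq1[simplified] spectral_bump_nonneg[OF assms] split: split_indicator)
  finally show ?thesis by simp
qed

text \<open>Comparison with the normalisation of \<open>\<psi>\<close>: after rescaling, the area
  factor \<open>s^2\<close> exceeds the weight \<open>1/s\<close> by \<open>s^3\<close>, which is at
  most 8 where \<open>\<psi>\<close> lives. This turns \<open>4 * pi\<close> into
  \<open>32 * pi\<close>.\<close>

lemma nn_integral_spectral_bump_norm_le:
  assumes \<psi>: "spectral_bump \<psi>" and K: "K > 0"
  shows "(\<integral>\<^sup>+\<xi>. ennreal (\<psi> (norm (\<xi> :: real^3) / K)) \<partial>lborel) \<le> ennreal (32 * pi * K ^ 3)"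
proof -
  note [measurable] = spectral_bump_measurable[OF \<psi>]
  have "(\<integral>\<^sup>+\<xi>. ennreal (\<psi> (norm (\<xi> :: real^3) / K)) \<partial>lborel)
      = (\<integral>\<^sup>+r\<in>{0..}. ennreal (4 * pi * r\<^sup>2) * ennreal (\<psi> (r / K)) \<partial>lborel)"
    by (rule nn_integral_radial_3[of "\<lambda>r. ennreal (\<psi> (r / K))"]) measurable
  \<comment> \<open>Substitution \<open>r = K * s\<close>; the outer factor \<open>K\<close> is the
    Jacobian.\<close>
  also have "\<dots> = ennreal K * (\<integral>\<^sup>+s. ennreal (4 * pi * (K * s)\<^sup>2) * ennreal (\<psi> s) * indicator {0..} (K * s) \<partial>lborel)"
    using K by (subst nn_integral_real_affine[where c = K and t = 0]) auto
  also have "\<dots> \<le> ennreal K * (\<integral>\<^sup>+s. ennreal (32 * pi * K\<^sup>2) * (ennreal (\<psi> s / s) * indicator {0<..} s) \<partial>lborel)"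
  proof (intro mult_left_mono nn_integral_mono)
    fix s :: real
    show "ennreal (4 * pi * (K * s)\<^sup>2) * ennreal (\<psi> s) * indicator {0..} (K * s)
        \<le> ennreal (32 * pi * K\<^sup>2) * (ennreal (\<psi> s / s) * indicator {0<..} s)"
    proof (cases "0 < s \<and> s \<le> 2")
      case True
      have "s ^ 3 \<le> 2 ^ 3"
        using True by (intro power_mono) auto
      then have "4 * pi * K\<^sup>2 * (\<psi> s / s) * s ^ 3 \<le> 4 * pi * K\<^sup>2 * (\<psi> s / s) * 8"
        using True spectral_bump_nonneg[OF \<psi>] K by (intro mult_left_mono) auto
      then have "4 * pi * (K * s)\<^sup>2 * \<psi> s \<le> 32 * pi * K\<^sup>2 * (\<psi> s / s)"
        using True by (simp add: power_mult_distrib power2_eq_square power3_eq_cube mult_ac)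
      then show ?thesis
        using True K spectral_bump_nonneg[OF \<psi>]
        by (simp add: ennreal_mult'[symmetric] indicator_def)
    next
      case False
      \<comment> \<open>The left side vanishes in each case: through the indicator, the factor
        \<open>(K * s)^2\<close>, or the bump.\<close>
      then consider "s < 0" | "s = 0" | "\<psi> s = 0"
        using spectral_bump_eq_0[OF \<psi>, of s] by linarith
      then show ?thesis
        using K by cases (auto simp: indicator_def mult_less_0_iff zero_le_mult_iff)
    qed
  qed simp
  also have "\<dots> = ennreal K * ennreal (32 * pi * K\<^sup>2)"
    by (subst nn_integral_cmult) (auto simp: nn_integral_spectral_bump[OF \<psi>])
  also have "\<dots> = ennreal (32 * pi * K ^ 3)"
    using K by (simp add: ennreal_mult'[symmetric] power2_eq_square power3_eq_cube mult_ac)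
  finally show ?thesis .
qed

section \<open>Uniform bound on the Fourier transform\<close>

lemma cell_measurable [measurable]: "cell \<Omega> \<in> sets borel"
proof (cases \<Omega>)
  case (Torus L)
  have "{x :: real^3. \<forall>i. 0 \<le> x $ i \<and> x $ i < L} \<in> sets borel"
    by measurable
  then show ?thesis using Torus by simp
qed simp

text \<open>If \<open>L1_norm \<Omega> f = \<infinity>\<close>, both sides are \<open>0\<close>: the integral defining \<open>fourier\<close> does not converge.\<close>

lemma norm_fourier_le:
  "norm (fourier \<Omega> f \<xi>) \<le> enn2real (L1_norm \<Omega> f)"
proof -
  let ?g = "\<lambda>x. indicator (cell \<Omega>) x *\<^sub>R
    (\<chi> j. exp (- \<i> * complex_of_real (x \<bullet> \<xi>)) * complex_of_real (f x $ j)) :: complex^3"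
  have F: "fourier \<Omega> f \<xi> = integral\<^sup>L lborel ?g"
    by (simp add: fourier_def set_lebesgue_integral_def)
  \<comment> \<open>The phase has modulus 1, and the Euclidean norm of the whole vector is kept, so
    passing from three components to one norm costs no constant.\<close>
  have norm_g: "norm (?g x) = norm (f x) * indicator (cell \<Omega>) x" for x
    by (simp add: norm_vec_def norm_mult L2_set_def indicator_def)
  show ?thesis
  proof (cases "integrable lborel ?g")
    case True
    have "norm (fourier \<Omega> f \<xi>) \<le> (LINT x|lborel. norm (?g x))"
      unfolding F by (rule integral_norm_bound)
    also have "\<dots> = enn2real (\<integral>\<^sup>+x. ennreal (norm (?g x)) \<partial>lborel)"
      by (intro integral_eq_nn_integral borel_measurable_integrable integrable_norm True AE_I2 norm_ge_zero)
    also have "(\<integral>\<^sup>+x. ennreal (norm (?g x)) \<partial>lborel) = L1_norm \<Omega> f"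
      unfolding norm_g L1_norm_def by (intro nn_integral_cong) (auto split: split_indicator)
    finally show ?thesis .
  next
    case False
    then show ?thesis by (simp add: F not_integrable_integral_eq)
  qed
qed

lemma norm_fourier_sq_le:
  "(norm (fourier \<Omega> f \<xi>))\<^sup>2 \<le> (enn2real (L1_norm \<Omega> f))\<^sup>2"
  by (intro power_mono norm_fourier_le) simp

text \<open>Equality except at \<open>\<infinity>\<close>, which \<open>enn2real\<close> sends to
  \<open>0\<close>.\<close>

lemma ennreal_enn2real_sq_le: "ennreal ((enn2real x)\<^sup>2) \<le> x\<^sup>2"
  by (cases x) (auto simp: ennreal_power)

section \<open>Spectral bounds at a fixed time\<close>

lemma E_star_le:
  assumes \<psi>: "spectral_bump \<psi>" and K: "K > 0"
  shows "E_star \<psi> K f \<le> ennreal (4 / pi\<^sup>2 * K\<^sup>2) * (L1_norm Whole f)\<^sup>2"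
proof -
  note [measurable] = spectral_bump_measurable[OF \<psi>]
  let ?B = "(enn2real (L1_norm Whole f))\<^sup>2"
  have "(\<integral>\<^sup>+\<xi>. ennreal (\<psi> (norm \<xi> / K) * (norm (fourier Whole f \<xi>))\<^sup>2 / (2 * pi) ^ 3) \<partial>lborel)
      \<le> (\<integral>\<^sup>+\<xi>. ennreal (?B / (2 * pi) ^ 3) * ennreal (\<psi> (norm (\<xi> :: real^3) / K)) \<partial>lborel)"
    using spectral_bump_nonneg[OF \<psi>] norm_fourier_sq_le[of Whole f]
    by (intro nn_integral_mono)
       (auto simp: ennreal_mult'[symmetric] mult.commute intro!: ennreal_leI divide_right_mono mult_mono)
  also have "\<dots> = ennreal (?B / (2 * pi) ^ 3) * (\<integral>\<^sup>+\<xi>. ennreal (\<psi> (norm (\<xi> :: real^3) / K)) \<partial>lborel)"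
    by (intro nn_integral_cmult) measurable
  also have "\<dots> \<le> ennreal (?B / (2 * pi) ^ 3) * ennreal (32 * pi * K ^ 3)"
    by (intro mult_left_mono nn_integral_spectral_bump_norm_le \<psi> K) simp
  finally have "E_star \<psi> K f \<le> ennreal (1 / K) * (ennreal (?B / (2 * pi) ^ 3) * ennreal (32 * pi * K ^ 3))"
    unfolding E_star_def by (auto intro!: mult_left_mono)
  \<comment> \<open>\<open>(1 / K) * 32 * pi * K^3 / (2 * pi)^3 = 4 * K^2 / pi^2\<close>.\<close>
  also have "\<dots> = ennreal (4 / pi\<^sup>2 * K\<^sup>2) * ennreal ?B"
    using K by (simp add: ennreal_mult'[symmetric] field_simps power2_eq_square power3_eq_cube)
  also have "\<dots> \<le> ennreal (4 / pi\<^sup>2 * K\<^sup>2) * (L1_norm Whole f)\<^sup>2"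
    by (intro mult_left_mono ennreal_enn2real_sq_le) simp
  finally show ?thesis .
qed

text \<open>Scaling by \<open>2 * pi / L\<close> is a bijection from the integer lattice onto the
  dual lattice and multiplies norms by that factor, so it matches the two spheres.\<close>

lemma card_dual_lattice_sphere:
  assumes L: "L > 0" and K: "K = 2 * pi / L * sqrt (real n)"
  shows "card {k \<in> dual_lattice L. norm k = K} = card {z :: int^3. (\<Sum>i\<in>UNIV. (z $ i)\<^sup>2) = int n}"
proof -
  define c where "c = 2 * pi / L"
  have c: "c > 0" using L by (simp add: c_def)
  define h :: "int^3 \<Rightarrow> real^3" where "h z = (\<chi> i. c * of_int (z $ i))" for z
  have norm_h: "norm (h z) = K \<longleftrightarrow> (\<Sum>i\<in>UNIV. (z $ i)\<^sup>2) = int n" for z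
  proof -
    have "norm (h z) = c * sqrt (of_int (\<Sum>i\<in>UNIV. (z $ i)\<^sup>2))"
      using c by (simp add: h_def norm_vec_def L2_set_def power_mult_distrib
          sum_distrib_left[symmetric] real_sqrt_mult)
    then have "norm (h z) = K \<longleftrightarrow> real_of_int (\<Sum>i\<in>UNIV. (z $ i)\<^sup>2) = real_of_int (int n)"
      using c by (simp add: K c_def[symmetric])
    then show ?thesis
      unfolding of_int_eq_iff .
  qed
  have "inj h"
    using c by (auto simp: inj_def h_def vec_eq_iff)
  moreover have "dual_lattice L = range h"
  proof -
    have "k \<in> range h" if "k \<in> dual_lattice L" for k
    proof -
      obtain m :: "3 \<Rightarrow> int" where "\<forall>i. k $ i = c * of_int (m i)"
        using \<open>k \<in> dual_lattice L\<close> unfolding dual_lattice_def c_def by simp metis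
      then have "k = h (\<chi> i. m i)"
        by (simp add: h_def vec_eq_iff)
      then show ?thesis by blast
    qed
    then show ?thesis
      by (auto simp: dual_lattice_def h_def c_def)
  qed
  then have "{k \<in> dual_lattice L. norm k = K} = h ` {z. (\<Sum>i\<in>UNIV. (z $ i)\<^sup>2) = int n}"
    by (auto simp: norm_h[symmetric])
  ultimately show ?thesis
    by (simp add: card_image inj_on_subset)
qed

text \<open>At most \<open>?B\<close> for each lattice point on the sphere. The factor
  \<open>rho (Torus L)\<close> is kept separate so that the energy can absorb it after
  averaging.\<close>

lemma E_dagger_le:
  fixes n :: nat
  assumes L: "L > 0" and n: "n \<ge> 1" and K: "K = 2 * pi / L * sqrt (real n)"
  shows "E_dagger L K f \<le> ennreal (K\<^sup>2 * (1 / (8 * pi ^ 3 * sqrt (real n))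
      * real (card {z :: int^3. (\<Sum>i\<in>UNIV. (z $ i)\<^sup>2) = int n})) * rho (Torus L))
    * (L1_norm (Torus L) f)\<^sup>2"
proof -
  let ?N = "real (card {z :: int^3. (\<Sum>i\<in>UNIV. (z $ i)\<^sup>2) = int n})"
  let ?B = "(enn2real (L1_norm (Torus L) f))\<^sup>2"
  let ?a = "1 / (2 * pi)\<^sup>2 * rho (Torus L) * (K / L)"
  have a: "0 \<le> ?a"
    using L by (simp add: K)
  \<comment> \<open>The relation between \<open>K\<close> and \<open>n\<close> gives
    \<open>K / L = K^2 / (2 * pi * sqrt n)\<close>; here \<open>n \<ge> 1\<close> keeps the
    denominator nonzero.\<close>
  have const: "?a = K\<^sup>2 * (1 / (8 * pi ^ 3 * sqrt (real n))) * rho (Torus L)"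
    using L n by (simp add: K field_simps power2_eq_square power3_eq_cube)
  have aN: "0 \<le> ?a * ?N"
    by (rule mult_nonneg_nonneg[OF a of_nat_0_le_iff])
  have "(\<Sum>k\<in>{k \<in> dual_lattice L. norm k = K}. (norm (fourier (Torus L) f k))\<^sup>2) \<le> ?N * ?B"
    unfolding card_dual_lattice_sphere[OF L K, symmetric]
    by (rule sum_bounded_above) (rule norm_fourier_sq_le)
  then have "E_dagger L K f \<le> ennreal (?a * (?N * ?B))"
    unfolding E_dagger_def using a by (intro ennreal_leI mult_left_mono)
  also have "\<dots> = ennreal (?a * ?N) * ennreal ?B"
    unfolding mult.assoc[symmetric] using aN by (rule ennreal_mult) simp
  also have "\<dots> \<le> ennreal (?a * ?N) * (L1_norm (Torus L) f)\<^sup>2"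
    by (intro mult_left_mono ennreal_enn2real_sq_le) simp
  finally show ?thesis
    unfolding const by (simp add: mult_ac)
qed

section \<open>Measurability and null slices\<close>

lemma leray_time_slice_measurable:
  assumes "leray_solution \<Omega> \<nu> u0 u" and "0 \<le> t"
  shows "u t \<in> borel_measurable borel"
proof -
  have u: "(\<lambda>(t, x). u t x) \<in> borel_measurable (restrict_space borel ({0..} \<times> UNIV))"
    using assms by (simp add: leray_solution_def)
  have "(\<lambda>x. (t, x)) \<in> measurable borel (restrict_space borel ({0..} \<times> UNIV))"
    using \<open>0 \<le> t\<close>
    by (intro measurable_restrict_space2 borel_measurable_continuous_onI continuous_intros) auto
  from measurable_compose[OF this u] show ?thesis by simp
qed

text \<open>Tonelli measurability, with \<open>\<phi>\<close> left free to serve both the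
  \<open>L1\<close> norm (identity) and the squared \<open>L2\<close> norm (square).\<close>

lemma leray_norm_integral_measurable:
  fixes \<phi> :: "real \<Rightarrow> real"
  assumes "leray_solution \<Omega> \<nu> u0 u" and "0 \<le> T0" and [measurable]: "\<phi> \<in> borel_measurable borel"
  shows "(\<lambda>t. (\<integral>\<^sup>+x\<in>cell \<Omega>. ennreal (\<phi> (norm (u t x))) \<partial>lborel) * indicator {T0..T1} t)
    \<in> borel_measurable borel"
proof -
  have "(\<lambda>(t, x). u t x) \<in> borel_measurable (restrict_space borel ({0..} \<times> UNIV))"
    using assms by (simp add: leray_solution_def)
  \<comment> \<open>Extension by zero to negative times gives a Borel function on all of space-time;
    since \<open>T0 \<ge> 0\<close>, nothing changes on \<open>{T0..T1}\<close>.\<close>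
  then have "(\<lambda>p. indicator ({0..} \<times> UNIV) p *\<^sub>R (\<lambda>(t, x). u t x) p) \<in> borel_measurable borel"
    by (subst (asm) borel_measurable_restrict_space_iff) (auto intro: borel_closed closed_Times)
  then have [measurable]:
    "(\<lambda>p. indicator ({0..} \<times> UNIV) p *\<^sub>R (\<lambda>(t, x). u t x) p) \<in> borel_measurable (borel \<Otimes>\<^sub>M lborel)"
    unfolding borel_prod[symmetric] by (simp cong: measurable_cong_sets)
  have "(\<lambda>t. (\<integral>\<^sup>+x\<in>cell \<Omega>. ennreal (\<phi> (norm (indicator ({0..} \<times> UNIV) (t, x) *\<^sub>R
      (case (t, x) of (t, x) \<Rightarrow> u t x)))) \<partial>lborel) * indicator {T0..T1} t) \<in> borel_measurable borel"
    by measurable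
  also have "?this \<longleftrightarrow> ?thesis"
    using \<open>0 \<le> T0\<close> by (intro measurable_cong) (auto simp: indicator_def)
  finally show ?thesis .
qed

text \<open>Serves the degenerate case in which the denominator of \<open>Vol\<close> is
  zero.\<close>

lemma L1_norm_eq_0:
  assumes [measurable]: "f \<in> borel_measurable borel" and "L2_norm_sq \<Omega> f = 0"
  shows "L1_norm \<Omega> f = 0"
proof -
  have "AE x in lborel. ennreal ((norm (f x))\<^sup>2) * indicator (cell \<Omega>) x = 0"
    using assms by (subst nn_integral_0_iff_AE[symmetric]) (auto simp: L2_norm_sq_def)
  then have "AE x in lborel. ennreal (norm (f x)) * indicator (cell \<Omega>) x = 0"
    by eventually_elim (auto split: split_indicator)
  then show ?thesis
    unfolding L1_norm_def by (subst nn_integral_0_iff_AE) auto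
qed

section \<open>Time averages along a Leray solution\<close>

context
  fixes \<Omega> \<nu> u0 u and T0 T1 :: real
  assumes leray: "leray_solution \<Omega> \<nu> u0 u" and T0: "0 \<le> T0" and T1: "T0 < T1"
begin

lemma L1_norm_time_measurable:
  "(\<lambda>t. (L1_norm \<Omega> (u t))\<^sup>2 * indicator {T0..T1} t) \<in> borel_measurable borel"
proof -
  have [measurable]: "(\<lambda>t. L1_norm \<Omega> (u t) * indicator {T0..T1} t) \<in> borel_measurable borel"
    using leray_norm_integral_measurable[OF leray T0, of "\<lambda>r. r"] by (simp add: L1_norm_def)
  have "(\<lambda>t. (L1_norm \<Omega> (u t) * indicator {T0..T1} t)\<^sup>2) \<in> borel_measurable borel"
    by measurable
  also have "(\<lambda>t. (L1_norm \<Omega> (u t) * indicator {T0..T1} t)\<^sup>2)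
      = (\<lambda>t. (L1_norm \<Omega> (u t))\<^sup>2 * indicator {T0..T1} t)"
    by (auto split: split_indicator)
  finally show ?thesis .
qed

lemma L2_norm_sq_time_measurable:
  "(\<lambda>t. L2_norm_sq \<Omega> (u t) * indicator {T0..T1} t) \<in> borel_measurable borel"
  using leray_norm_integral_measurable[OF leray T0, of "\<lambda>r. r\<^sup>2"] by (simp add: L2_norm_sq_def)

text \<open>Follows from the essential bound in time on the \<open>L2\<close> norm; it permits
  cancelling the denominator of \<open>Vol\<close>.\<close>

lemma time_average_L2_norm_sq_finite: "time_average T0 T1 (\<lambda>t. L2_norm_sq \<Omega> (u t)) \<noteq> \<infinity>"
proof -
  obtain C :: real where C: "AE t in lborel. 0 \<le> t \<longrightarrow> L2_norm_sq \<Omega> (u t) \<le> ennreal C"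
    using leray by (auto simp: leray_solution_def)
  have "(\<integral>\<^sup>+t\<in>{T0..T1}. L2_norm_sq \<Omega> (u t) \<partial>lborel) \<le> (\<integral>\<^sup>+t\<in>{T0..T1}. ennreal C \<partial>lborel)"
    by (rule nn_integral_mono_AE, use C in eventually_elim) (use T0 in \<open>auto split: split_indicator\<close>)
  also have "\<dots> < \<infinity>"
    using T1 by (simp add: nn_integral_cmult_indicator ennreal_mult_less_top)
  finally show ?thesis
    using T1 by (simp add: time_average_def ennreal_divide_eq_top_iff)
qed

lemma time_average_energy:
  "time_average T0 T1 (\<lambda>t. energy \<Omega> (u t))
    = ennreal (rho \<Omega>) * time_average T0 T1 (\<lambda>t. L2_norm_sq \<Omega> (u t))"
  using L2_norm_sq_time_measurable
  by (simp add: time_average_def energy_def mult.assoc nn_integral_cmult ennreal_times_divide)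

text \<open>Clearing the denominator of \<open>Vol\<close> is legitimate when it is neither
  \<open>0\<close> nor \<open>\<infinity>\<close>. If it is \<open>0\<close>, almost every slice is
  null, so the numerator is \<open>0\<close> as well and both sides vanish.\<close>

lemma time_average_L1_norm_sq:
  "time_average T0 T1 (\<lambda>t. (L1_norm \<Omega> (u t))\<^sup>2)
    = Vol \<Omega> u T0 T1 * time_average T0 T1 (\<lambda>t. L2_norm_sq \<Omega> (u t))"
proof (cases "time_average T0 T1 (\<lambda>t. L2_norm_sq \<Omega> (u t)) = 0")
  case True
  then have "(\<integral>\<^sup>+t. L2_norm_sq \<Omega> (u t) * indicator {T0..T1} t \<partial>lborel) = 0"
    by (simp add: time_average_def)
  then have "AE t in lborel. L2_norm_sq \<Omega> (u t) * indicator {T0..T1} t = 0"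
    using L2_norm_sq_time_measurable by (subst nn_integral_0_iff_AE[symmetric]) auto
  then have "AE t in lborel. (L1_norm \<Omega> (u t))\<^sup>2 * indicator {T0..T1} t = 0"
    by eventually_elim
      (use T0 in \<open>auto simp: L1_norm_eq_0 leray_time_slice_measurable[OF leray] split: split_indicator\<close>)
  then have "(\<integral>\<^sup>+t. (L1_norm \<Omega> (u t))\<^sup>2 * indicator {T0..T1} t \<partial>lborel) = 0"
    using L1_norm_time_measurable by (subst nn_integral_0_iff_AE) auto
  then show ?thesis
    using True by (simp add: time_average_def)
next
  case False
  then show ?thesis
    using time_average_L2_norm_sq_finite
    by (simp add: Vol_def ennreal_divide_times ennreal_times_divide[symmetric] ennreal_divide_self less_top)
qed

text \<open>The averaging step common to both domains: \<open>F\<close> is the spectrum of a slice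
  at fixed \<open>K\<close>, and \<open>c\<close> collects \<open>K^2\<close> and the constant of
  the domain.\<close>

lemma time_average_le_Vol_energy:
  assumes bound: "\<And>f. F f \<le> ennreal (c * rho \<Omega>) * (L1_norm \<Omega> f)\<^sup>2" and "0 \<le> c"
  shows "time_average T0 T1 (\<lambda>t. F (u t))
    \<le> ennreal c * Vol \<Omega> u T0 T1 * time_average T0 T1 (\<lambda>t. energy \<Omega> (u t))"
proof -
  \<comment> \<open>Monotonicity comes first, so that the constant is pulled out of the measurable
    \<open>L1\<close> integrand only.\<close>
  have "(\<integral>\<^sup>+t\<in>{T0..T1}. F (u t) \<partial>lborel)
      \<le> (\<integral>\<^sup>+t. ennreal (c * rho \<Omega>) * ((L1_norm \<Omega> (u t))\<^sup>2 * indicator {T0..T1} t) \<partial>lborel)"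
    by (intro nn_integral_mono) (auto simp: bound split: split_indicator)
  also have "\<dots> = ennreal (c * rho \<Omega>) * (\<integral>\<^sup>+t\<in>{T0..T1}. (L1_norm \<Omega> (u t))\<^sup>2 \<partial>lborel)"
    using L1_norm_time_measurable by (intro nn_integral_cmult) simp
  finally have "time_average T0 T1 (\<lambda>t. F (u t))
      \<le> ennreal (c * rho \<Omega>) * time_average T0 T1 (\<lambda>t. (L1_norm \<Omega> (u t))\<^sup>2)"
    unfolding time_average_def by (simp add: ennreal_times_divide divide_right_mono_ennreal)
  also have "\<dots> = ennreal c * Vol \<Omega> u T0 T1 * time_average T0 T1 (\<lambda>t. energy \<Omega> (u t))"
    using \<open>0 \<le> c\<close> by (simp add: time_average_L1_norm_sq time_average_energy ennreal_mult' mult_ac)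
  finally show ?thesis .
qed

end

theorem theorem9:
  fixes \<nu> L :: real and \<psi> :: "real \<Rightarrow> real"
  assumes "\<nu> > 0" and "L > 0" and "spectral_bump \<psi>"
  shows
    "(\<forall>u0 u T0 T1.
        leray_solution Whole \<nu> u0 u \<and> in_L1 Whole u0 \<and> 0 \<le> T0 \<and> T0 < T1 \<longrightarrow>
        (\<forall>K::real. K > 0 \<longrightarrow>
           time_average T0 T1 (\<lambda>t. E_star \<psi> K (u t))
             \<le> ennreal (4 / pi\<^sup>2) * Vol Whole u T0 T1 * ennreal (K\<^sup>2)
                 * time_average T0 T1 (\<lambda>t. energy Whole (u t))))
     \<and>
     (\<forall>u0 u T0 T1.
        leray_solution (Torus L) \<nu> u0 u \<and> in_L1 (Torus L) u0 \<and> 0 \<le> T0 \<and> T0 < T1 \<longrightarrow>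
        (\<forall>(n::nat) K. n \<ge> 1 \<and> (\<exists>a b c::int. int n = a\<^sup>2 + b\<^sup>2 + c\<^sup>2) \<and> K = 2 * pi / L * sqrt (real n) \<longrightarrow>
           time_average T0 T1 (\<lambda>t. E_dagger L K (u t))
             \<le> Vol (Torus L) u T0 T1 * ennreal (K\<^sup>2) * time_average T0 T1 (\<lambda>t. energy (Torus L) (u t))
                 * ennreal (1 / (8 * pi ^ 3 * sqrt (real n))
                     * real (card {z :: int^3. (\<Sum>i\<in>UNIV. (z $ i)\<^sup>2) = int n}))))"
proof (intro conjI allI impI; elim conjE)
  fix u0 u and T0 T1 K :: real
  assume u: "leray_solution Whole \<nu> u0 u" "0 \<le> T0" "T0 < T1" and K: "0 < K"
  \<comment> \<open>Here \<open>c = 4 / pi^2 * K^2\<close>, and \<open>rho Whole = 1\<close> brings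
    \<open>E_star_le\<close> into the required form.\<close>
  have "time_average T0 T1 (\<lambda>t. E_star \<psi> K (u t))
      \<le> ennreal (4 / pi\<^sup>2 * K\<^sup>2) * Vol Whole u T0 T1 * time_average T0 T1 (\<lambda>t. energy Whole (u t))"
    using E_star_le[OF \<open>spectral_bump \<psi>\<close> K] by (intro time_average_le_Vol_energy[OF u]) auto
  also have "ennreal (4 / pi\<^sup>2 * K\<^sup>2) = ennreal (4 / pi\<^sup>2) * ennreal (K\<^sup>2)"
    by (rule ennreal_mult) auto
  finally show "time_average T0 T1 (\<lambda>t. E_star \<psi> K (u t))
      \<le> ennreal (4 / pi\<^sup>2) * Vol Whole u T0 T1 * ennreal (K\<^sup>2)
        * time_average T0 T1 (\<lambda>t. energy Whole (u t))"
    by (simp add: mult_ac)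
next
  fix u0 u and T0 T1 :: real and n :: nat and K :: real
  assume u: "leray_solution (Torus L) \<nu> u0 u" "0 \<le> T0" "T0 < T1"
    and n: "1 \<le> n" and K: "K = 2 * pi / L * sqrt (real n)"
  let ?c = "1 / (8 * pi ^ 3 * sqrt (real n)) * real (card {z :: int^3. (\<Sum>i\<in>UNIV. (z $ i)\<^sup>2) = int n})"
  have c: "0 \<le> ?c" by simp
  \<comment> \<open>Here \<open>c = K^2 * ?c\<close>; the remaining \<open>rho (Torus L)\<close> in
    \<open>E_dagger_le\<close> is the one in the energy.\<close>
  have "time_average T0 T1 (\<lambda>t. E_dagger L K (u t))
      \<le> ennreal (K\<^sup>2 * ?c) * Vol (Torus L) u T0 T1 * time_average T0 T1 (\<lambda>t. energy (Torus L) (u t))"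
    using c by (intro time_average_le_Vol_energy[OF u] E_dagger_le[OF \<open>L > 0\<close> n K]) simp
  also have "ennreal (K\<^sup>2 * ?c) = ennreal (K\<^sup>2) * ennreal ?c"
    using c by (intro ennreal_mult) auto
  finally show "time_average T0 T1 (\<lambda>t. E_dagger L K (u t))
      \<le> Vol (Torus L) u T0 T1 * ennreal (K\<^sup>2) * time_average T0 T1 (\<lambda>t. energy (Torus L) (u t))
        * ennreal ?c"
    by (simp only: mult_ac)
qed

end
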